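(* Let $H$ be a graph with $|E(H)|\ge 3$ and let $k,t$ be integers with $k=\binom{t}{2}\ge 6$. Then $$\operatorname{GM}_{k-1}(P_4:H)=\begin{cases}8, & t=4;\\ 12\binom{t}{4}-2(t-3), & t\ge 5.\end{cases}$$
   Context: All graphs are finite, simple and without isolated vertices. $P_n$ is the path on $n$ vertices. A $k$-edge-coloring of a graph is a map from its edge set onto $\{1,\dots,k\}$ that is exact, i.e. every one of the $k$ colors is used at least once. An edge-colored graph is rainbow if all its edges have distinct colors and monochromatic if all its edges have the same color. A copy of a graph $F$ in a graph $G$ is a subgraph of $G$ isomorphic to $F$; distinct copies are distinct subgraphs. For non-empty graphs $G,H$ and a positive integer $k$, the Gallai-Ramsey number $\operatorname{gr}_k(G:H)$ is the minimum integer $N$ such that for all $n\ge N$, every (exact) $k$-edge-coloring of $K_n$ contains a rainbow copy of $G$ or a monochromatic copy of $H$. The Gallai-Ramsey multiplicity $\operatorname{GM}_k(G:H)$ is the minimum, over all (exact) $k$-edge-colorings of $K_{\operatorname{gr}_k(G:H)}$, of the total number of rainbow copies of $G$ plus monochromatic copies of $H$.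
   Formalization: The Gallai-Ramsey number gr_k(G:H) is taken as the least N that also admits an exact k-edge-coloring of K_N; without this the condition holds vacuously at small N and the multiplicity would be a minimum over no colorings. *)

theory Defs
  imports Main
begin

text \<open>A graph is a pair of a vertex set and a set of edges, each edge being a two-element
  set of vertices.\<close>

type_synonym 'a ugraph = "'a set \<times> 'a set set"

abbreviation verts :: "'a ugraph \<Rightarrow> 'a set" where "verts \<equiv> fst"
abbreviation edges :: "'a ugraph \<Rightarrow> 'a set set" where "edges \<equiv> snd"

definition simple_graph :: "'a ugraph \<Rightarrow> bool" where
  "simple_graph G \<longleftrightarrow> finite (verts G) \<and> (\<forall>e\<in>edges G. e \<subseteq> verts G \<and> card e = 2)"

definition no_isolated_vertices :: "'a ugraph \<Rightarrow> bool" where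
  "no_isolated_vertices G \<longleftrightarrow> (\<forall>v\<in>verts G. \<exists>e\<in>edges G. v \<in> e)"

definition subgraph :: "'a ugraph \<Rightarrow> 'a ugraph \<Rightarrow> bool" where
  "subgraph S G \<longleftrightarrow> simple_graph S \<and> verts S \<subseteq> verts G \<and> edges S \<subseteq> edges G"

definition isomorphic :: "'a ugraph \<Rightarrow> 'b ugraph \<Rightarrow> bool" where
  "isomorphic F G \<longleftrightarrow>
     (\<exists>f. bij_betw f (verts F) (verts G) \<and> (\<lambda>e. f ` e) ` edges F = edges G)"

definition copies :: "'a ugraph \<Rightarrow> 'b ugraph \<Rightarrow> 'b ugraph set" where
  "copies F G = {S. subgraph S G \<and> isomorphic F S}"

definition complete_graph :: "nat \<Rightarrow> nat ugraph" where
  "complete_graph n = ({..<n}, {e. e \<subseteq> {..<n} \<and> card e = 2})"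

definition path_graph :: "nat \<Rightarrow> nat ugraph" where
  "path_graph n = ({..<n}, {{i, Suc i} | i. Suc i < n})"

text \<open>Colorings are total functions on sets; values outside the edge set of the graph are
  never inspected.\<close>

definition exact_coloring :: "nat \<Rightarrow> 'a ugraph \<Rightarrow> ('a set \<Rightarrow> nat) \<Rightarrow> bool" where
  "exact_coloring k G c \<longleftrightarrow> c ` edges G = {1..k}"

definition rainbow :: "('a set \<Rightarrow> nat) \<Rightarrow> 'a ugraph \<Rightarrow> bool" where
  "rainbow c S \<longleftrightarrow> inj_on c (edges S)"

definition monochromatic :: "('a set \<Rightarrow> nat) \<Rightarrow> 'a ugraph \<Rightarrow> bool" where
  "monochromatic c S \<longleftrightarrow> (\<exists>a. \<forall>e\<in>edges S. c e = a)"

definition rainbow_copies :: "'a ugraph \<Rightarrow> 'b ugraph \<Rightarrow> ('b set \<Rightarrow> nat) \<Rightarrow> 'b ugraph set" where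
  "rainbow_copies F K c = {S \<in> copies F K. rainbow c S}"

definition mono_copies :: "'a ugraph \<Rightarrow> 'b ugraph \<Rightarrow> ('b set \<Rightarrow> nat) \<Rightarrow> 'b ugraph set" where
  "mono_copies F K c = {S \<in> copies F K. monochromatic c S}"

text \<open>The first conjunct below is implicit in the usual definition: without it, every
  \<open>N\<close> for which \<open>K\<^sub>N\<close> has fewer than \<open>k\<close> edges would satisfy the
  Ramsey condition vacuously at \<open>n = N\<close>, so that the minimum could be attained at an
  order with no exact \<open>k\<close>-edge-coloring, and the Gallai-Ramsey multiplicity would
  be a minimum over the empty set.\<close>

definition gallai_ramsey_number :: "nat \<Rightarrow> 'a ugraph \<Rightarrow> 'b ugraph \<Rightarrow> nat" where
  "gallai_ramsey_number k G H =
     (LEAST N. (\<exists>c. exact_coloring k (complete_graph N) c) \<and>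
        (\<forall>n\<ge>N. \<forall>c. exact_coloring k (complete_graph n) c \<longrightarrow>
           rainbow_copies G (complete_graph n) c \<noteq> {} \<or>
           mono_copies H (complete_graph n) c \<noteq> {}))"

definition gallai_ramsey_multiplicity :: "nat \<Rightarrow> 'a ugraph \<Rightarrow> 'b ugraph \<Rightarrow> nat" where
  "gallai_ramsey_multiplicity k G H =
     (let K = complete_graph (gallai_ramsey_number k G H) in
      LEAST m. \<exists>c. exact_coloring k K c \<and>
        m = card (rainbow_copies G K c) + card (mono_copies H K c))"

end

theory Submission
  imports Defs
begin

text \<open>Since \<open>K\<^sub>t\<close> has \<open>k\<close> edges, an exact \<open>(k - 1)\<close>-coloring of it repeats exactly one
  color, on exactly two edges \<open>e\<close> and \<open>f\<close>. Hence no copy of \<open>H\<close> is monochromatic, and a path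
  fails to be rainbow iff it contains both \<open>e\<close> and \<open>f\<close>. There are \<open>2 (t - 3)\<close> such paths if
  \<open>e\<close> and \<open>f\<close> are adjacent and \<open>4\<close> if they are disjoint, out of \<open>12 (t choose 4)\<close> paths in
  total. The Gallai-Ramsey number is \<open>t\<close> because fewer vertices give too few edges, while four
  colors on a complete graph of any order already force a rainbow \<open>P\<^sub>4\<close>:
  without one, two disjoint edges of different colors confine all edges to these two colors, while
  if disjoint edges always share their color, the perfect matchings of one \<open>K\<^sub>4\<close> supply all
  colors.\<close>

section \<open>Copies of \<open>P_4\<close> in \<open>K_n\<close> and their number\<close>

definition path4 :: "'a \<Rightarrow> 'a \<Rightarrow> 'a \<Rightarrow> 'a \<Rightarrow> 'a ugraph" where
  "path4 a b c d = ({a, b, c, d}, {{a, b}, {b, c}, {c, d}})"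

lemma path4_rev: "path4 a b c d = path4 d c b a"
  by (auto simp: path4_def insert_commute)

text \<open>The middle edge is the one that meets both others, so the edge set fixes the vertex
  sequence up to reversal.\<close>

lemma path4_eq_iff:
  assumes "distinct [a, b, c, d]" "distinct [a', b', c', d']"
  shows "path4 a b c d = path4 a' b' c' d' \<longleftrightarrow>
    (a = a' \<and> b = b' \<and> c = c' \<and> d = d') \<or> (a = d' \<and> b = c' \<and> c = b' \<and> d = a')"
proof
  assume eq: "path4 a b c d = path4 a' b' c' d'"
  have E: "{{a, b}, {b, c}, {c, d}} = {{a', b'}, {b', c'}, {c', d'}}"
    using eq by (simp only: path4_def prod.inject)
  \<comment> \<open>Membership of each edge on the left in the right-hand set already carries enough
    information; the rest is a case distinction on which edge goes where.\<close>
  have e: "{a, b} \<in> {{a', b'}, {b', c'}, {c', d'}}" "{b, c} \<in> {{a', b'}, {b', c'}, {c', d'}}"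
    "{c, d} \<in> {{a', b'}, {b', c'}, {c', d'}}"
    unfolding E[symmetric] by simp_all
  show "(a = a' \<and> b = b' \<and> c = c' \<and> d = d') \<or> (a = d' \<and> b = c' \<and> c = b' \<and> d = a')"
    using e assms by (simp add: doubleton_eq_iff) metis
next
  assume "(a = a' \<and> b = b' \<and> c = c' \<and> d = d') \<or> (a = d' \<and> b = c' \<and> c = b' \<and> d = a')"
  then show "path4 a b c d = path4 a' b' c' d'"
    using path4_rev[of a b c d] by (elim disjE conjE) simp_all
qed

lemma edges_path_graph_4: "edges (path_graph 4) = {{0, 1}, {1, 2}, {2, 3}}"
proof -
  have "{i. Suc i < 4} = {0, 1, 2}" by auto
  moreover have "edges (path_graph 4) = (\<lambda>i. {i, Suc i}) ` {i. Suc i < 4}"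
    by (auto simp: path_graph_def)
  ultimately show ?thesis by (simp add: numeral_eq_Suc)
qed

lemma verts_path_graph_4: "verts (path_graph 4) = {0, 1, 2, 3}"
  by (auto simp: path_graph_def)

text \<open>This trades isomorphisms for vertex quadruples: an isomorphism is recorded by the images
  of 0, 1, 2, 3. The same copy is listed under two quadruples.\<close>

lemma copies_path4:
  "copies (path_graph 4) (complete_graph n) =
    {path4 a b c d | a b c d. distinct [a, b, c, d] \<and> {a, b, c, d} \<subseteq> {..<n}}"
proof (intro equalityI subsetI)
  fix S :: "nat ugraph" assume "S \<in> copies (path_graph 4) (complete_graph n)"
  then obtain f where S: "subgraph S (complete_graph n)"
    and f: "bij_betw f {0, 1, 2, 3 :: nat} (verts S)"
    and e: "(\<lambda>e. f ` e) ` {{0, 1}, {1, 2}, {2, 3}} = edges S"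
    unfolding copies_def isomorphic_def edges_path_graph_4 verts_path_graph_4 by auto
  have "S = path4 (f 0) (f 1) (f 2) (f 3)"
    using e f unfolding path4_def bij_betw_def by (intro prod_eqI) auto
  moreover have "distinct [f 0, f 1, f 2, f 3]"
    using f by (auto simp: bij_betw_def inj_on_def)
  moreover have "{f 0, f 1, f 2, f 3} \<subseteq> {..<n}"
    using f S by (auto simp: bij_betw_def subgraph_def complete_graph_def)
  ultimately show "S \<in> {path4 a b c d | a b c d. distinct [a, b, c, d] \<and> {a, b, c, d} \<subseteq> {..<n}}"
    by blast
next
  fix S :: "nat ugraph"
  assume "S \<in> {path4 a b c d | a b c d. distinct [a, b, c, d] \<and> {a, b, c, d} \<subseteq> {..<n}}"
  then obtain a b c d where S: "S = path4 a b c d" and d: "distinct [a, b, c, d]"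
    and n: "{a, b, c, d} \<subseteq> {..<n}" by blast
  define f where "f i = [a, b, c, d] ! i" for i
  \<comment> \<open>The value at 1 also appears in the form \<open>Suc 0\<close>, to which the
    simplifier rewrites \<open>1\<close>.\<close>
  have f: "f 0 = a" "f 1 = b" "f 2 = c" "f 3 = d" "f (Suc 0) = b"
    by (auto simp: f_def)
  have "isomorphic (path_graph 4) S"
    unfolding isomorphic_def edges_path_graph_4 verts_path_graph_4
    by (intro exI[of _ f]) (use d in \<open>auto simp: bij_betw_def inj_on_def f S path4_def\<close>)
  moreover have "subgraph S (complete_graph n)"
    using d n by (auto simp: S path4_def subgraph_def simple_graph_def complete_graph_def)
  ultimately show "S \<in> copies (path_graph 4) (complete_graph n)"
    by (auto simp: copies_def)
qed

text \<open>The denominator-free form of the falling factorial quotient. For \<open>n < 4\<close>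
  both sides are 0, since some factor on the right vanishes.\<close>

lemma fact_4_mult_choose_4: "24 * (n choose 4) = n * (n - 1) * (n - 2) * (n - 3)"
proof (cases "n < 4")
  case True
  then consider "n = 0" | "n = 1" | "n = 2" | "n = 3" by linarith
  then show ?thesis by cases auto
next
  case False
  define m where "m = n - 4"
  have n: "n = Suc (Suc (Suc (Suc m)))" using False by (simp add: m_def)
  have "fact 4 * fact m * (n choose 4) = fact n"
    using binomial_fact_lemma[of 4 n] False by (simp add: m_def)
  also have "fact n = n * (n - 1) * (n - 2) * (n - 3) * fact m"
    by (simp add: n algebra_simps numeral_eq_Suc)
  finally have "24 * (n choose 4) * fact m = n * (n - 1) * (n - 2) * (n - 3) * fact m"
    by (simp add: fact_numeral mult_ac)
  then show ?thesis by simp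
qed

text \<open>Each path comes from exactly two lists of distinct vertices, a list and its reversal.
  \<open>A\<close> keeps the list whose first end is the smaller one, so it contains half of all
  \<open>24 * (n choose 4)\<close> lists.\<close>

lemma card_copies_path4:
  assumes "n \<ge> 4"
  shows "finite (copies (path_graph 4) (complete_graph n))"
    and "card (copies (path_graph 4) (complete_graph n)) = 12 * (n choose 4)"
proof -
  define L where "L = {xs. length xs = 4 \<and> distinct xs \<and> set xs \<subseteq> {..<n}}"
  define A where "A = {xs \<in> L. hd xs < last xs}"
  define g where "g xs = path4 (xs ! 0) (xs ! 1) (xs ! 2) (xs ! 3)" for xs :: "nat list"
  have L: "xs \<in> L \<longleftrightarrow> (\<exists>a b c d. xs = [a, b, c, d] \<and> distinct [a, b, c, d] \<and> {a, b, c, d} \<subseteq> {..<n})"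
    for xs by (auto simp: L_def numeral_eq_Suc length_Suc_conv)
  have finL: "finite L"
    unfolding L_def by (rule finite_subset[OF _ finite_lists_length_eq[of "{..<n}" 4]]) auto
  then have finA: "finite A" by (simp add: A_def)
  have "card L = \<Prod>{n - 4 + 1..n}"
    unfolding L_def using card_lists_distinct_length_eq[of "{..<n}" 4] assms by simp
  also have "{n - 4 + 1..n} = {n - 3, n - 2, n - 1, n}" using assms by auto
  also have "\<Prod>{n - 3, n - 2, n - 1, n} = n * (n - 1) * (n - 2) * (n - 3)"
  proof -
    \<comment> \<open>The product ranges over a set, so it splits into four factors only once these
      are known to differ.\<close>
    have "distinct [n - 3, n - 2, n - 1, n]" using assms by auto
    then show ?thesis by (simp add: mult_ac del: One_nat_def)
  qed
  finally have cardL: "card L = 24 * (n choose 4)" by (simp add: fact_4_mult_choose_4)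
  have "L = A \<union> rev ` A"
  proof (intro equalityI subsetI)
    fix xs assume xs: "xs \<in> L"
    show "xs \<in> A \<union> rev ` A"
    proof (cases "hd xs < last xs")
      case False
      then have "rev xs \<in> A" using xs by (auto simp: A_def L)
      then show ?thesis by (metis UnI2 imageI rev_rev_ident)
    qed (use xs in \<open>auto simp: A_def\<close>)
  qed (auto simp: A_def L)
  moreover have "A \<inter> rev ` A = {}" by (auto simp: A_def L)
  ultimately have "card L = card A + card (rev ` A)"
    using finA by (simp add: card_Un_disjoint)
  also have "card (rev ` A) = card A" by (simp add: card_image)
  finally have cardA: "card A = 12 * (n choose 4)" using cardL by simp
  have inj: "inj_on g A"
  proof (rule inj_onI)
    fix xs ys assume xy: "xs \<in> A" "ys \<in> A" and eq: "g xs = g ys"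
    obtain a b c d where x: "xs = [a, b, c, d]" "distinct [a, b, c, d]"
      using xy(1) unfolding A_def L by blast
    obtain a' b' c' d' where y: "ys = [a', b', c', d']" "distinct [a', b', c', d']"
      using xy(2) unfolding A_def L by blast
    have "path4 a b c d = path4 a' b' c' d'" using eq by (simp add: g_def x(1) y(1))
    moreover have "a < d" "a' < d'" using xy by (simp_all add: A_def x(1) y(1))
    ultimately show "xs = ys" unfolding path4_eq_iff[OF x(2) y(2)] x(1) y(1) by auto
  qed
  have img: "copies (path_graph 4) (complete_graph n) = g ` A"
  proof (intro equalityI subsetI)
    fix S assume "S \<in> copies (path_graph 4) (complete_graph n)"
    then obtain a b c d where S: "S = path4 a b c d" and d: "distinct [a, b, c, d]"
      and n: "{a, b, c, d} \<subseteq> {..<n}" unfolding copies_path4 by blast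
    show "S \<in> g ` A"
    proof (cases "a < d")
      case True
      then have "[a, b, c, d] \<in> A" using d n by (auto simp: A_def L)
      moreover have "S = g [a, b, c, d]" by (simp add: g_def S)
      ultimately show ?thesis by blast
    next
      case False
      then have "[d, c, b, a] \<in> A" using d n by (auto simp: A_def L)
      moreover have "S = g [d, c, b, a]" by (simp add: g_def S path4_rev)
      ultimately show ?thesis by blast
    qed
  next
    fix S assume "S \<in> g ` A"
    then obtain xs where xs: "xs \<in> L" "S = g xs" by (auto simp: A_def)
    then obtain a b c d where "xs = [a, b, c, d]" "distinct [a, b, c, d]" "{a, b, c, d} \<subseteq> {..<n}"
      using L by blast
    with xs show "S \<in> copies (path_graph 4) (complete_graph n)"
      unfolding copies_path4 by (auto simp: g_def)
  qed
  show "finite (copies (path_graph 4) (complete_graph n))"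
    using finA by (simp add: img)
  show "card (copies (path_graph 4) (complete_graph n)) = 12 * (n choose 4)"
    using cardA by (simp add: img card_image[OF inj])
qed

section \<open>Paths containing two given edges\<close>

definition paths_through :: "nat \<Rightarrow> nat set \<Rightarrow> nat set \<Rightarrow> nat ugraph set" where
  "paths_through n e f = {S \<in> copies (path_graph 4) (complete_graph n). e \<in> edges S \<and> f \<in> edges S}"

text \<open>Such a path contains a, b, c as consecutive vertices, and the fourth vertex, one of n -
  3, is attached either at a or at c.\<close>

lemma card_paths_through_adjacent:
  assumes "distinct [a, b, c]" "{a, b, c} \<subseteq> {..<n}"
  shows "card (paths_through n {a, b} {b, c}) = 2 * (n - 3)"
proof -
  define X where "X = {..<n} - {a, b, c}"
  have eq: "paths_through n {a, b} {b, c} = (\<lambda>x. path4 x a b c) ` X \<union> (\<lambda>x. path4 a b c x) ` X"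
  proof (intro equalityI subsetI)
    fix S assume "S \<in> paths_through n {a, b} {b, c}"
    then obtain p q r s where S: "S = path4 p q r s" and d: "distinct [p, q, r, s]"
      and n: "{p, q, r, s} \<subseteq> {..<n}"
      and e: "{a, b} \<in> {{p, q}, {q, r}, {r, s}}" "{b, c} \<in> {{p, q}, {q, r}, {r, s}}"
      unfolding paths_through_def copies_path4 by (auto simp: path4_def)
    \<comment> \<open>The segment occupies the last or the first three places and is read in either
      direction; reversal then reduces these four cases to the two families.\<close>
    have "(q, r, s) = (a, b, c) \<or> (q, r, s) = (c, b, a) \<or> (p, q, r) = (a, b, c) \<or> (p, q, r) = (c, b, a)"
      using d e assms(1) by (simp add: doubleton_eq_iff) metis
    then show "S \<in> (\<lambda>x. path4 x a b c) ` X \<union> (\<lambda>x. path4 a b c x) ` X"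
    proof (elim disjE)
      assume "(q, r, s) = (a, b, c)"
      then show ?thesis using d n by (intro UnI1 image_eqI[of _ _ p]) (auto simp: S X_def)
    next
      assume "(q, r, s) = (c, b, a)"
      then show ?thesis using d n path4_rev[of p c b a]
        by (intro UnI2 image_eqI[of _ _ p]) (auto simp: S X_def)
    next
      assume "(p, q, r) = (a, b, c)"
      then show ?thesis using d n by (intro UnI2 image_eqI[of _ _ s]) (auto simp: S X_def)
    next
      assume "(p, q, r) = (c, b, a)"
      then show ?thesis using d n path4_rev[of c b a s]
        by (intro UnI1 image_eqI[of _ _ s]) (auto simp: S X_def)
    qed
  next
    fix S assume S: "S \<in> (\<lambda>x. path4 x a b c) ` X \<union> (\<lambda>x. path4 a b c x) ` X"
    then have "S \<in> copies (path_graph 4) (complete_graph n)"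
      using assms unfolding copies_path4 X_def by fastforce
    with S show "S \<in> paths_through n {a, b} {b, c}"
      by (auto simp: paths_through_def path4_def)
  qed
  have d: "distinct [x, a, b, c]" "distinct [a, b, c, x]" if "x \<in> X" for x
    using assms(1) that by (auto simp: X_def)
  have "inj_on (\<lambda>x. path4 x a b c) X"
    using d path4_eq_iff[OF d(1) d(1)] by (intro inj_onI) auto
  moreover have "inj_on (\<lambda>x. path4 a b c x) X"
    using d path4_eq_iff[OF d(2) d(2)] by (intro inj_onI) auto
  \<comment> \<open>The families are disjoint because a is an inner vertex in the first and an end
    in the second.\<close>
  moreover have "path4 x a b c \<noteq> path4 a b c y" if "x \<in> X" "y \<in> X" for x y
    unfolding path4_eq_iff[OF d(1)[OF that(1)] d(2)[OF that(2)]] using assms(1) by auto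
  then have "(\<lambda>x. path4 x a b c) ` X \<inter> (\<lambda>x. path4 a b c x) ` X = {}" by blast
  moreover have "card X = n - 3"
    using assms by (simp add: X_def card_Diff_subset)
  moreover have "finite X" by (simp add: X_def)
  ultimately show ?thesis by (simp add: eq card_Un_disjoint card_image)
qed

text \<open>Disjoint edges of a \<open>P_4\<close> are its two outer edges, so the path is
  determined by its middle edge, which joins an end of the one to an end of the other: 2 * 2
  choices.\<close>

lemma card_paths_through_disjoint:
  assumes "distinct [a, b, c, d]" "{a, b, c, d} \<subseteq> {..<n}"
  shows "card (paths_through n {a, b} {c, d}) = 4"
proof -
  have eq: "paths_through n {a, b} {c, d} = {path4 a b c d, path4 a b d c, path4 b a c d, path4 b a d c}"
    (is "_ = ?R")
  proof (intro equalityI subsetI)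
    fix S assume "S \<in> paths_through n {a, b} {c, d}"
    then obtain p q r s where S: "S = path4 p q r s" and d: "distinct [p, q, r, s]"
      and e: "{a, b} \<in> {{p, q}, {q, r}, {r, s}}" "{c, d} \<in> {{p, q}, {q, r}, {r, s}}"
      unfolding paths_through_def copies_path4 by (auto simp: path4_def)
    have "({a, b} = {p, q} \<and> {c, d} = {r, s}) \<or> ({a, b} = {r, s} \<and> {c, d} = {p, q})"
      using d e assms(1) by (simp add: doubleton_eq_iff) metis
    moreover have "S = path4 s r q p" using S path4_rev by simp
    ultimately show "S \<in> ?R"
      using S unfolding doubleton_eq_iff by (elim disjE conjE) simp_all
  next
    fix S assume S: "S \<in> ?R"
    then have "S \<in> copies (path_graph 4) (complete_graph n)"
      using assms unfolding copies_path4 by fastforce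
    with S show "S \<in> paths_through n {a, b} {c, d}"
      by (auto simp: paths_through_def path4_def insert_commute)
  qed
  have "distinct [path4 a b c d, path4 a b d c, path4 b a c d, path4 b a d c]"
    using assms(1) path4_eq_iff[of a b c d a b d c] path4_eq_iff[of a b c d b a c d]
      path4_eq_iff[of a b c d b a d c] path4_eq_iff[of a b d c b a c d]
      path4_eq_iff[of a b d c b a d c] path4_eq_iff[of b a c d b a d c] by auto
  then show ?thesis unfolding eq by simp
qed

lemma card_edges_complete_graph: "card (edges (complete_graph n)) = n choose 2"
  using n_subsets[of "{..<n}" 2] by (simp add: complete_graph_def)

lemma finite_edges_complete_graph: "finite (edges (complete_graph n))"
  by (rule finite_subset[of _ "Pow {..<n}"]) (auto simp: complete_graph_def)

text \<open>Two different edges are disjoint or share one end, which gives the two terms. The first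
  is larger at \<open>n = 4\<close>, they agree at \<open>n = 5\<close>, and the second is larger
  from then on.\<close>

lemma card_paths_through_le:
  assumes "e \<in> edges (complete_graph n)" "f \<in> edges (complete_graph n)" "e \<noteq> f"
  shows "card (paths_through n e f) \<le> max 4 (2 * (n - 3))"
proof -
  obtain a b c d where e: "e = {a, b}" "a \<noteq> b" and f: "f = {c, d}" "c \<noteq> d"
    using assms by (auto simp: complete_graph_def card_2_iff)
  have n: "{a, b, c, d} \<subseteq> {..<n}"
    using assms by (auto simp: complete_graph_def e f)
  show ?thesis
  proof (cases "distinct [a, b, c, d]")
    case True
    then show ?thesis using card_paths_through_disjoint[OF True n] by (simp add: e f)
  next
    case False
    then obtain p q r where "e = {p, q}" "f = {q, r}" "distinct [p, q, r]" "{p, q, r} \<subseteq> {..<n}"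
    proof -
      have "a = c \<or> a = d \<or> b = c \<or> b = d" using False e f by auto
      then show thesis
        using that[of b a d] that[of b a c] that[of a b d] that[of a b c] e f n assms(3)
        by (elim disjE) (auto simp: insert_commute)
    qed
    then show ?thesis using card_paths_through_adjacent[of p q r n] by simp
  qed
qed

section \<open>Colorings without a rainbow \<open>P_4\<close> have at most three colors\<close>

lemma rainbow_path_free_colors:
  fixes col :: "'a \<Rightarrow> 'a \<Rightarrow> 'b"
  assumes sym: "\<And>x y. col x y = col y x"
    and nr: "\<And>a b c d. distinct [a, b, c, d] \<Longrightarrow> {a, b, c, d} \<subseteq> V \<Longrightarrow>
      \<not> distinct [col a b, col b c, col c d]"
    and d4: "distinct [a\<^sub>0, b\<^sub>0, c\<^sub>0, d\<^sub>0]" and V4: "{a\<^sub>0, b\<^sub>0, c\<^sub>0, d\<^sub>0} \<subseteq> V"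
  obtains C where "finite C" "card C \<le> 3"
    "\<And>x y. x \<in> V \<Longrightarrow> y \<in> V \<Longrightarrow> x \<noteq> y \<Longrightarrow> col x y \<in> C"
proof -
  \<comment> \<open>First the edges at an end of one of two differently colored disjoint edges. If
    ax had a third color, the paths through it would force ac to have the color of cd and bc that of
    ab, and then x, a, c, b would be a rainbow path.\<close>
  have L1: "col a x = col a b \<or> col a x = col c d"
    if d: "distinct [a, b, c, d]" "x \<noteq> a" and V: "{a, b, c, d, x} \<subseteq> V" and ne: "col a b \<noteq> col c d"
    for a b c d x
  proof (rule ccontr)
    assume A: "\<not> ?thesis"
    have x: "x \<notin> {a, b, c, d}"
      using A d V nr[of b a c d] nr[of b a d c] ne sym by auto
    have "col a c = col c d" using nr[of x a c d] nr[of b a c d] x d V A ne sym by auto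
    moreover have "col b c = col a b" using nr[of x a b c] nr[of a b c d] x d V A ne sym by auto
    ultimately show False using nr[of x a c b] x d V A ne sym by auto
  qed
  \<comment> \<open>Now arbitrary edges. By \<open>L1\<close> at all four ends, an edge xy of a
    third color avoids a, b, c, d. Applying \<open>L1\<close> also to the pairs ab, xy and cd, xy
    shows that ax has the color of ab and cy that of cd, so a, x, y, c is a rainbow path.\<close>
  have L2: "col x y = col a b \<or> col x y = col c d"
    if d: "distinct [a, b, c, d]" "x \<noteq> y" and V: "{a, b, c, d, x, y} \<subseteq> V"
      and ne: "col a b \<noteq> col c d" for a b c d x y
  proof (rule ccontr)
    assume A: "\<not> ?thesis"
    have on: "col z w = col a b \<or> col z w = col c d"
      if "z \<in> {a, b, c, d}" "w \<noteq> z" "w \<in> V" for z w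
      using L1[of a b c d w] L1[of b a c d w] L1[of c d a b w] L1[of d c a b w]
        that d V ne sym[of b a] sym[of d c] by auto
    have xy: "x \<notin> {a, b, c, d}" "y \<notin> {a, b, c, d}"
      using on[of x y] on[of y x] A d V sym[of x y] by auto
    have "col a x = col a b"
      using on[of a x] L1[of a b x y x] xy d V A ne by auto
    moreover have "col c y = col c d"
      using on[of c y] L1[of c d x y y] xy d V A ne by auto
    ultimately show False using nr[of a x y c] xy d V A ne sym[of y c] by auto
  qed
  show thesis
  proof (cases "\<exists>a b c d. distinct [a, b, c, d] \<and> {a, b, c, d} \<subseteq> V \<and> col a b \<noteq> col c d")
    case True
    then obtain a b c d where "distinct [a, b, c, d]" "{a, b, c, d} \<subseteq> V" "col a b \<noteq> col c d"
      by blast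
    then show thesis
      using L2[of a b c d] by (intro that[of "{col a b, col c d}"]) (auto simp: card_insert_if)
  next
    case False
    then have same: "col a b = col c d"
      if "distinct [a, b, c, d]" "{a, b, c, d} \<subseteq> V" for a b c d
      using that by blast
    \<comment> \<open>One edge at \<open>a\<^sub>0\<close> from each of the three perfect matchings
      of the \<open>K_4\<close>. Three colors can really occur: a \<open>K_4\<close> whose perfect
      matchings have different colors has no rainbow \<open>P_4\<close>.\<close>
    let ?C = "{col a\<^sub>0 b\<^sub>0, col a\<^sub>0 c\<^sub>0, col a\<^sub>0 d\<^sub>0}"
    have K4: "col c\<^sub>0 d\<^sub>0 \<in> ?C" "col b\<^sub>0 d\<^sub>0 \<in> ?C" "col b\<^sub>0 c\<^sub>0 \<in> ?C"
      using same[of a\<^sub>0 b\<^sub>0 c\<^sub>0 d\<^sub>0] same[of a\<^sub>0 c\<^sub>0 b\<^sub>0 d\<^sub>0] same[of a\<^sub>0 d\<^sub>0 b\<^sub>0 c\<^sub>0] d4 V4 by auto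
    have "col x y \<in> ?C" if xy: "x \<in> V" "y \<in> V" "x \<noteq> y" for x y
    proof (cases "x \<in> {a\<^sub>0, b\<^sub>0, c\<^sub>0, d\<^sub>0} \<and> y \<in> {a\<^sub>0, b\<^sub>0, c\<^sub>0, d\<^sub>0}")
      case True
      then show ?thesis using K4 xy(3) sym by auto
    next
      case False
      \<comment> \<open>The edge \<open>xy\<close> has at most one end in the \<open>K\<^sub>4\<close>, so it misses an edge of it.\<close>
      then obtain p q where "p \<in> {a\<^sub>0, b\<^sub>0, c\<^sub>0, d\<^sub>0}" "q \<in> {a\<^sub>0, b\<^sub>0, c\<^sub>0}" "p \<noteq> q" "distinct [x, y, p, q]"
        "col p q \<in> ?C"
      proof -
        have "distinct [x, y, a\<^sub>0, b\<^sub>0] \<or> distinct [x, y, d\<^sub>0, c\<^sub>0]"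
          using False d4 xy(3) by auto
        then show thesis using that[of a\<^sub>0 b\<^sub>0] that[of d\<^sub>0 c\<^sub>0] K4(1) sym[of d\<^sub>0 c\<^sub>0] d4 by auto
      qed
      then show ?thesis using same[of x y p q] xy V4 by auto
    qed
    then show thesis by (intro that[of ?C]) (auto simp: card_insert_if)
  qed
qed

text \<open>Four colors need more edges than \<open>K_3\<close> has, so the vertices 0, 1, 2, 3
  exist and the three-color bound applies; it contradicts the surjectivity of the coloring onto
  \<open>{1..k}\<close>.\<close>

lemma exists_rainbow_path4:
  assumes c: "exact_coloring k (complete_graph n) c" and "k \<ge> 4"
  shows "rainbow_copies (path_graph 4) (complete_graph n) c \<noteq> {}"
proof
  assume none: "rainbow_copies (path_graph 4) (complete_graph n) c = {}"
  have img: "c ` edges (complete_graph n) = {1..k}" using c by (simp add: exact_coloring_def)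
  have "k \<le> n choose 2"
    using card_image_le[OF finite_edges_complete_graph, of c n]
    by (simp add: img card_edges_complete_graph)
  have "n \<ge> 4"
  proof (rule ccontr)
    assume "\<not> n \<ge> 4"
    then have "n choose 2 \<le> 3 choose 2" by (intro binomial_right_mono) simp
    with \<open>k \<le> n choose 2\<close> \<open>k \<ge> 4\<close> show False by (simp add: choose_two)
  qed
  have nr: "\<not> distinct [c {x, y}, c {y, z}, c {z, w}]"
    if "distinct [x, y, z, w]" "{x, y, z, w} \<subseteq> {..<n}" for x y z w
  proof
    assume "distinct [c {x, y}, c {y, z}, c {z, w}]"
    then have "rainbow c (path4 x y z w)" by (auto simp: rainbow_def path4_def inj_on_def)
    then have "path4 x y z w \<in> rainbow_copies (path_graph 4) (complete_graph n) c"
      using that unfolding rainbow_copies_def copies_path4 by blast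
    with none show False by simp
  qed
  obtain C where C: "finite C" "card C \<le> 3"
    "\<And>x y. x \<in> {..<n} \<Longrightarrow> y \<in> {..<n} \<Longrightarrow> x \<noteq> y \<Longrightarrow> c {x, y} \<in> C"
    by (rule rainbow_path_free_colors[of "\<lambda>x y. c {x, y}" "{..<n}" 0 1 2 3])
      (use nr \<open>n \<ge> 4\<close> in \<open>auto simp: insert_commute\<close>)
  have "{1..k} \<subseteq> C"
    unfolding img[symmetric] by (auto simp: complete_graph_def card_2_iff intro!: C(3))
  then have "card {1..k} \<le> 3" using C card_mono le_trans by blast
  with \<open>k \<ge> 4\<close> show False by simp
qed

section \<open>Exact colorings with one color fewer than edges\<close>

lemma exact_coloring_repeated_pair:
  assumes fin: "finite (edges G)" and card: "card (edges G) = Suc k"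
    and c: "exact_coloring k G c"
  obtains e f where "e \<in> edges G" "f \<in> edges G" "e \<noteq> f"
    "\<And>E. E \<subseteq> edges G \<Longrightarrow> inj_on c E \<longleftrightarrow> \<not> (e \<in> E \<and> f \<in> E)"
proof -
  have img: "c ` edges G = {1..k}" using c by (simp add: exact_coloring_def)
  have "\<not> inj_on c (edges G)"
    using card_image[of c "edges G"] card img by auto
  then obtain e f where ef: "e \<in> edges G" "f \<in> edges G" "e \<noteq> f" "c e = c f"
    by (auto simp: inj_on_def)
  \<comment> \<open>Without x its partner still supplies the common color, so the remaining k edges
    map onto k colors and hence injectively.\<close>
  have inj: "inj_on c (edges G - {x})" if x: "x \<in> {e, f}" for x
  proof (rule eq_card_imp_inj_on)
    obtain y where y: "y \<in> edges G - {x}" "c y = c x"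
      using ef x by (cases "x = e") auto
    have "c ` edges G \<subseteq> c ` (edges G - {x})"
    proof
      fix a assume "a \<in> c ` edges G"
      then obtain z where "z \<in> edges G" "a = c z" by blast
      with y show "a \<in> c ` (edges G - {x})" by (cases "z = x") (auto intro: image_eqI[of _ c y])
    qed
    then have "c ` (edges G - {x}) = c ` edges G" by blast
    then show "card (c ` (edges G - {x})) = card (edges G - {x})"
      using card x ef by (auto simp: img fin)
  qed (simp add: fin)
  \<comment> \<open>This one criterion serves to test both rainbow paths and monochromatic copies of
    \<open>H\<close>.\<close>
  have "inj_on c E \<longleftrightarrow> \<not> (e \<in> E \<and> f \<in> E)" if "E \<subseteq> edges G" for E
  proof
    assume "\<not> (e \<in> E \<and> f \<in> E)"
    then have "E \<subseteq> edges G - {e} \<or> E \<subseteq> edges G - {f}" using that by auto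
    then show "inj_on c E"
      using inj_on_subset[OF inj[of e]] inj_on_subset[OF inj[of f]] by auto
  next
    assume "inj_on c E"
    then show "\<not> (e \<in> E \<and> f \<in> E)" using ef(3,4) inj_onD[of c E e f] by blast
  qed
  with ef show thesis by (intro that[of e f]) auto
qed

lemma exact_coloring_with_repeated_pair:
  assumes fin: "finite (edges G)" and card: "card (edges G) = Suc k"
    and ef: "e \<in> edges G" "f \<in> edges G" "e \<noteq> f"
  obtains c where "exact_coloring k G c" "c e = c f"
proof -
  obtain h where h: "bij_betw h (edges G - {f}) {1..k}"
    using finite_same_card_bij[of "edges G - {f}" "{1..k}"] fin card ef by auto
  have "(h(f := h e)) ` edges G = h ` (edges G - {f})"
    using ef by (auto simp: image_iff)
  then have "exact_coloring k G (h(f := h e))"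
    using h by (simp add: exact_coloring_def bij_betw_def)
  then show thesis using that[of "h(f := h e)"] ef by simp
qed

text \<open>Removing e from a monochromatic copy leaves at least two edges, on which
  \<open>c\<close> would be both injective and constant.\<close>

lemma mono_copies_empty:
  assumes H: "simple_graph H" "card (edges H) \<ge> 3"
    and inj: "\<And>E. E \<subseteq> edges G \<Longrightarrow> inj_on c E \<longleftrightarrow> \<not> (e \<in> E \<and> f \<in> E)"
  shows "mono_copies H G c = {}"
proof (rule ccontr)
  assume "mono_copies H G c \<noteq> {}"
  then obtain S a where S: "isomorphic H S" "edges S \<subseteq> edges G" and a: "\<forall>x\<in>edges S. c x = a"
    by (auto simp: mono_copies_def copies_def subgraph_def monochromatic_def)
  from S(1) obtain g where g: "bij_betw g (verts H) (verts S)" "(\<lambda>x. g ` x) ` edges H = edges S"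
    by (auto simp: isomorphic_def)
  have "inj_on (\<lambda>x. g ` x) (edges H)"
  proof (rule inj_on_subset)
    show "inj_on (\<lambda>x. g ` x) (Pow (verts H))"
      using g(1) by (simp add: bij_betw_def inj_on_image_Pow)
    show "edges H \<subseteq> Pow (verts H)" using H(1) by (auto simp: simple_graph_def)
  qed
  then have "card (edges S) = card (edges H)" using g(2) card_image by metis
  moreover have "inj_on c (edges S - {e})" using inj[of "edges S - {e}"] S(2) by auto
  then have "card (c ` (edges S - {e})) = card (edges S - {e})" by (rule card_image)
  moreover have "card (c ` (edges S - {e})) \<le> card {a}"
    using a by (intro card_mono) auto
  moreover have "card (edges S) - 1 \<le> card (edges S - {e})"
    using diff_card_le_card_Diff[of "{e}" "edges S"] by simp
  ultimately show False using H(2) by simp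
qed

lemma card_rainbow_copies_path4:
  assumes "n \<ge> 4"
    and inj: "\<And>E. E \<subseteq> edges (complete_graph n) \<Longrightarrow> inj_on c E \<longleftrightarrow> \<not> (e \<in> E \<and> f \<in> E)"
  shows "card (rainbow_copies (path_graph 4) (complete_graph n) c) =
    12 * (n choose 4) - card (paths_through n e f)"
proof -
  have "rainbow_copies (path_graph 4) (complete_graph n) c =
      copies (path_graph 4) (complete_graph n) - paths_through n e f"
    using inj by (auto simp: rainbow_copies_def paths_through_def rainbow_def copies_def subgraph_def)
  moreover have "paths_through n e f \<subseteq> copies (path_graph 4) (complete_graph n)"
    by (auto simp: paths_through_def)
  ultimately show ?thesis
    using card_copies_path4[OF assms(1)] by (metis card_Diff_subset finite_subset)
qed

section \<open>The Gallai-Ramsey number and the multiplicity\<close>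

lemma gallai_ramsey_number_path4:
  assumes "t \<ge> 4" "t choose 2 = Suc k"
  shows "gallai_ramsey_number k (path_graph 4) H = t"
  unfolding gallai_ramsey_number_def
proof (rule Least_equality)
  have six: "6 \<le> t choose 2" using binomial_right_mono[OF assms(1), of 2] by (simp add: choose_two)
  \<comment> \<open>Any two different edges would do as the repeated pair; they witness that
    \<open>K_t\<close> has an exact coloring with k colors.\<close>
  have "{0, 1} \<in> edges (complete_graph t)" "{1, 2} \<in> edges (complete_graph t)" "{0, 1} \<noteq> {1, 2::nat}"
    using assms(1) by (auto simp: complete_graph_def doubleton_eq_iff)
  then obtain c where "exact_coloring k (complete_graph t) c"
    using exact_coloring_with_repeated_pair[OF finite_edges_complete_graph] assms(2)
    by (metis card_edges_complete_graph)
  moreover have "k \<ge> 4" using six assms(2) by simp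
  ultimately show "(\<exists>c. exact_coloring k (complete_graph t) c) \<and>
    (\<forall>n\<ge>t. \<forall>c. exact_coloring k (complete_graph n) c \<longrightarrow>
      rainbow_copies (path_graph 4) (complete_graph n) c \<noteq> {} \<or> mono_copies H (complete_graph n) c \<noteq> {})"
    using exists_rainbow_path4 by blast
next
  fix N assume "(\<exists>c. exact_coloring k (complete_graph N) c) \<and>
    (\<forall>n\<ge>N. \<forall>c. exact_coloring k (complete_graph n) c \<longrightarrow>
      rainbow_copies (path_graph 4) (complete_graph n) c \<noteq> {} \<or> mono_copies H (complete_graph n) c \<noteq> {})"
  then obtain c where "c ` edges (complete_graph N) = {1..k}" by (auto simp: exact_coloring_def)
  \<comment> \<open>Minimality rests on the existence conjunct: \<open>K_N\<close> needs at least k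
    edges. Already \<open>K_{t-1}\<close> has too few, as dropping a vertex loses t - 1 \<ge> 3
    edges while k is only one below \<open>t choose 2\<close>.\<close>
  then have k: "k \<le> N choose 2"
    using card_image_le[OF finite_edges_complete_graph, of c N]
    by (simp add: card_edges_complete_graph)
  show "t \<le> N"
  proof (rule ccontr)
    assume "\<not> t \<le> N"
    then have "N choose 2 \<le> (t - 1) choose 2" by (intro binomial_right_mono) simp
    moreover have "t choose 2 = ((t - 1) choose 2) + (t - 1)"
      using assms(1) by (cases t) (simp_all add: numeral_2_eq_2)
    ultimately show False using k assms by linarith
  qed
qed

theorem theorem3p6:
  fixes H :: "'a ugraph" and k t :: nat
  assumes "simple_graph H" and "no_isolated_vertices H" and "card (edges H) \<ge> 3"
    and "k = t choose 2" and "k \<ge> 6"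
  shows "(t = 4 \<longrightarrow> gallai_ramsey_multiplicity (k - 1) (path_graph 4) H = 8) \<and>
    (t \<ge> 5 \<longrightarrow> int (gallai_ramsey_multiplicity (k - 1) (path_graph 4) H)
       = 12 * int (t choose 4) - 2 * (int t - 3))"
proof -
  \<comment> \<open>The maximum covers both cases of the theorem: it is 4 at \<open>t = 4\<close>,
    giving 12 - 4 = 8, and \<open>2 * (t - 3)\<close> from \<open>t = 5\<close> on.\<close>
  have "gallai_ramsey_multiplicity (k - 1) (path_graph 4) H = 12 * (t choose 4) - max 4 (2 * (t - 3))"
    (is "_ = ?m") if t: "t \<ge> 4"
  proof -
    let ?K = "complete_graph t"
    have k: "t choose 2 = Suc (k - 1)" using assms(4,5) by simp
    then have cardK: "card (edges ?K) = Suc (k - 1)" by (simp add: card_edges_complete_graph)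
    have copies_c: "card (rainbow_copies (path_graph 4) ?K c) + card (mono_copies H ?K c) =
        12 * (t choose 4) - card (paths_through t e f)"
      if "\<And>E. E \<subseteq> edges ?K \<Longrightarrow> inj_on c E \<longleftrightarrow> \<not> (e \<in> E \<and> f \<in> E)" for c e f
      using card_rainbow_copies_path4[OF t that] mono_copies_empty[OF assms(1,3) that] by simp
    \<comment> \<open>The extremal pair destroys the most rainbow paths: disjoint edges for
      \<open>t = 4\<close>, adjacent ones otherwise.\<close>
    obtain e f where ef: "e \<in> edges ?K" "f \<in> edges ?K" "e \<noteq> f"
      and max: "card (paths_through t e f) = max 4 (2 * (t - 3))"
    proof (cases "t = 4")
      case True
      then show thesis
        using that[of "{0, 1}" "{2, 3}"] card_paths_through_disjoint[of 0 1 2 3 t]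
        by (simp add: complete_graph_def doubleton_eq_iff)
    next
      case False
      then show thesis
        using t that[of "{0, 1}" "{1, 2}"] card_paths_through_adjacent[of 0 1 2 t]
        by (simp add: complete_graph_def doubleton_eq_iff)
    qed
    have "(LEAST m. \<exists>c. exact_coloring (k - 1) ?K c \<and>
        m = card (rainbow_copies (path_graph 4) ?K c) + card (mono_copies H ?K c)) = ?m"
    proof (rule Least_equality)
      obtain c where c: "exact_coloring (k - 1) ?K c" "c e = c f"
        using exact_coloring_with_repeated_pair[OF finite_edges_complete_graph cardK ef] by blast
      obtain e' f' where inj: "\<And>E. E \<subseteq> edges ?K \<Longrightarrow> inj_on c E \<longleftrightarrow> \<not> (e' \<in> E \<and> f' \<in> E)"
        using exact_coloring_repeated_pair[OF finite_edges_complete_graph cardK c(1)] by metis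
      \<comment> \<open>The pair e', f' extracted from the coloring must be the chosen pair:
        non-injectivity on \<open>{e, f}\<close> puts both into it, and injectivity on singletons
        keeps them apart.\<close>
      have "\<not> inj_on c {e, f}" using c(2) ef(3) by simp
      then have "{e', f'} \<subseteq> {e, f}" using inj[of "{e, f}"] ef by auto
      moreover have "e' \<noteq> f'" using inj[of "{e'}"] inj[of "{e}"] inj[of "{f}"] \<open>{e', f'} \<subseteq> {e, f}\<close> ef by auto
      ultimately have "paths_through t e' f' = paths_through t e f"
        by (auto simp: paths_through_def)
      then show "\<exists>c. exact_coloring (k - 1) ?K c \<and>
          ?m = card (rainbow_copies (path_graph 4) ?K c) + card (mono_copies H ?K c)"
        using c(1) copies_c[OF inj] max by auto
    next
      fix m assume "\<exists>c. exact_coloring (k - 1) ?K c \<and>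
          m = card (rainbow_copies (path_graph 4) ?K c) + card (mono_copies H ?K c)"
      then obtain c where c: "exact_coloring (k - 1) ?K c"
        and m: "m = card (rainbow_copies (path_graph 4) ?K c) + card (mono_copies H ?K c)" by blast
      obtain e' f' where "e' \<in> edges ?K" "f' \<in> edges ?K" "e' \<noteq> f'"
        and inj: "\<And>E. E \<subseteq> edges ?K \<Longrightarrow> inj_on c E \<longleftrightarrow> \<not> (e' \<in> E \<and> f' \<in> E)"
        using exact_coloring_repeated_pair[OF finite_edges_complete_graph cardK c] by metis
      moreover have "m = 12 * (t choose 4) - card (paths_through t e' f')"
        unfolding m by (rule copies_c) (rule inj)
      ultimately show "?m \<le> m"
        by (simp only:) (intro diff_le_mono2 card_paths_through_le)
    qed
    then show ?thesis
      unfolding gallai_ramsey_multiplicity_def Let_def gallai_ramsey_number_path4[OF t k] .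
  qed
  moreover have "int (12 * (t choose 4) - 2 * (t - 3)) = 12 * int (t choose 4) - 2 * (int t - 3)"
    if "t \<ge> 5"
  proof -
    \<comment> \<open>This makes the subtraction on natural numbers exact, so it passes to the
      integers. It holds because (t - 1)(t - 2)(t - 3) is at least 24 for t \<ge> 5.\<close>
    have "t \<le> t choose 4"
    proof -
      have "24 * t = t * (4 * 3 * 2)" by simp
      also have "\<dots> \<le> t * ((t - 1) * (t - 2) * (t - 3))"
        using that by (intro mult_le_mono) auto
      also have "\<dots> = 24 * (t choose 4)" by (simp only: fact_4_mult_choose_4 mult.assoc)
      finally show ?thesis by simp
    qed
    then show ?thesis using that by (simp add: of_nat_diff)
  qed
  ultimately show ?thesis by (auto simp: max_def)
qed

end
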